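(* Let $h \geq 1$ be an integer and let $0 = a_0(h) < a_1(h) < a_2(h) < a_3(h) < \cdots$ be the greedy $B_h$-set (so that $a_1(h) = 1$ and $a_2(h) = h+1$). Then \[ a_3(h) = h^2 + h + 1. \]
   Context: For an integer $h \geq 1$, a set $A$ of nonnegative integers is a $B_h$-set if every integer $n$ has at most one representation $n = a_{i_1} + a_{i_2} + \cdots + a_{i_h}$ with $a_{i_1}, \ldots, a_{i_h} \in A$ and $a_{i_1} \leq a_{i_2} \leq \cdots \leq a_{i_h}$ (i.e. at most one representation as a sum of $h$ not necessarily distinct elements of $A$, up to reordering of the summands). The greedy $B_h$-set $\{a_0(h), a_1(h), a_2(h), \ldots\}$ is defined inductively: $a_0(h) = 0$, and for $k \geq 1$, given the $B_h$-set $\{a_0(h), \ldots, a_{k-1}(h)\}$ with $a_0(h) < \cdots < a_{k-1}(h)$, $a_k(h)$ is the smallest integer with $a_k(h) > a_{k-1}(h)$ such that $\{a_0(h), \ldots, a_{k-1}(h), a_k(h)\}$ is a $B_h$-set. The element $a_k(h)$ is called the $k$th positive element of the greedy $B_h$-set. *)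

theory Defs
  imports "HOL-Library.Multiset"
begin

text \<open>
  Representations of \<open>n\<close> as a sum of \<open>h\<close> elements of \<open>A\<close>, up to order of the summands, are
  given by sorted lists. Sums of nonnegative integers are nonnegative, so it suffices
  that \<open>n\<close> ranges over \<^typ>\<open>nat\<close>.
\<close>

definition is_Bh_set :: "nat \<Rightarrow> nat set \<Rightarrow> bool" where
  "is_Bh_set h A \<longleftrightarrow>
     (\<forall>n. \<exists>\<^sub>\<le>\<^sub>1 xs. length xs = h \<and> set xs \<subseteq> A \<and> sorted xs \<and> sum_list xs = n)"

text \<open>
  The \<open>LEAST\<close> below always ranges over a nonempty set, see \<open>greedy_Bh_Suc_ex\<close>.
\<close>

fun greedy_Bh :: "nat \<Rightarrow> nat \<Rightarrow> nat" where
  "greedy_Bh h 0 = 0"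
| "greedy_Bh h (Suc k) =
     (LEAST n. greedy_Bh h k < n \<and> is_Bh_set h (insert n (greedy_Bh h ` {..k})))"

lemma is_Bh_set_iff_mset:
  "is_Bh_set h A \<longleftrightarrow>
     (\<forall>M N. size M = h \<longrightarrow> size N = h \<longrightarrow> set_mset M \<subseteq> A \<longrightarrow> set_mset N \<subseteq> A \<longrightarrow>
        sum_mset M = sum_mset N \<longrightarrow> M = N)"
proof (intro iffI allI impI)
  fix M N :: "nat multiset"
  assume B: "is_Bh_set h A" and MN: "size M = h" "size N = h" "set_mset M \<subseteq> A"
    "set_mset N \<subseteq> A" "sum_mset M = sum_mset N"
  have s: "sum_list (sorted_list_of_multiset K) = sum_mset K" for K :: "nat multiset"
    by (metis mset_sorted_list_of_multiset sum_mset_sum_list)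
  have l: "length (sorted_list_of_multiset K) = size K" for K :: "nat multiset"
    by (metis mset_sorted_list_of_multiset size_mset)
  have "sorted_list_of_multiset M = sorted_list_of_multiset N"
    using B MN unfolding is_Bh_set_def Uniq_def
    by (simp add: s l)
  then show "M = N"
    by (metis mset_sorted_list_of_multiset)
next
  assume *: "\<forall>M N. size M = h \<longrightarrow> size N = h \<longrightarrow> set_mset M \<subseteq> A \<longrightarrow> set_mset N \<subseteq> A \<longrightarrow>
        sum_mset M = sum_mset N \<longrightarrow> M = N"
  show "is_Bh_set h A"
    unfolding is_Bh_set_def Uniq_def
  proof (intro allI impI, elim conjE)
    fix n and xs ys :: "nat list"
    assume "length xs = h" "set xs \<subseteq> A" "sorted xs" "sum_list xs = n"
      "length ys = h" "set ys \<subseteq> A" "sorted ys" "sum_list ys = n"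
    moreover from this have "mset xs = mset ys"
      using *[rule_format, of "mset xs" "mset ys"] by (simp add: sum_mset_sum_list)
    ultimately show "ys = xs"
      by (metis properties_for_sort)
  qed
qed

lemma is_Bh_set_insert_large:
  assumes B: "is_Bh_set h A" and "0 \<in> A" and large: "\<And>a. a \<in> A \<Longrightarrow> h * a < m"
  shows "is_Bh_set h (insert m A)"
  unfolding is_Bh_set_iff_mset
proof (intro allI impI)
  fix M N :: "nat multiset"
  assume MN: "size M = h" "size N = h" "set_mset M \<subseteq> insert m A" "set_mset N \<subseteq> insert m A"
    and eq: "sum_mset M = sum_mset N"
  define r where "r K = filter_mset (\<lambda>x. x \<noteq> m) K" for K :: "nat multiset"
  have split: "K = r K + replicate_mset (count K m) m" for K
    by (rule multiset_eqI) (simp add: r_def)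
  have sz: "size K = size (r K) + count K m" for K
    by (metis split size_union size_replicate_mset)
  have sm: "sum_mset K = sum_mset (r K) + count K m * m" for K
    by (subst split, subst sum_mset.union) (simp add: sum_mset_replicate_mset)
  have rA: "set_mset (r K) \<subseteq> A" if "set_mset K \<subseteq> insert m A" for K
    using that by (auto simp: r_def)
  have bd: "size K \<le> h \<Longrightarrow> set_mset K \<subseteq> A \<Longrightarrow> sum_mset K < m" for K
  proof -
    assume K: "size K \<le> h" "set_mset K \<subseteq> A"
    show "sum_mset K < m"
    proof (cases "K = {#}")
      case True
      then show ?thesis using large[OF \<open>0 \<in> A\<close>] by simp
    next
      case False
      define b where "b = Max (set_mset K)"
      have "b \<in> A" using False K by (metis b_def Max_in finite_set_mset set_mset_eq_empty_iff subsetD)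
      have "sum_mset (image_mset id K) \<le> sum_mset (image_mset (\<lambda>_. b) K)"
        by (rule sum_mset_mono) (simp add: b_def)
      then have "sum_mset K \<le> size K * b" by simp
      also have "\<dots> \<le> h * b" using K by simp
      also have "\<dots> < m" using large \<open>b \<in> A\<close> by simp
      finally show ?thesis .
    qed
  qed
  have lt: "sum_mset (r M) < m" "sum_mset (r N) < m"
    using bd rA MN sz by (metis le_add1)+
  have "sum_mset M div m = count M m" "sum_mset N div m = count N m"
    using lt by (simp_all add: sm[of M] sm[of N])
  then have c: "count M m = count N m" using eq by simp
  let ?z = "replicate_mset (count N m) (0::nat)"
  have "r M + ?z = r N + ?z"
  proof (rule B[unfolded is_Bh_set_iff_mset, rule_format])
    show "size (r M + ?z) = h" "size (r N + ?z) = h"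
      using sz[of M] sz[of N] MN c by simp_all
    show "set_mset (r M + ?z) \<subseteq> A" "set_mset (r N + ?z) \<subseteq> A"
      using rA MN \<open>0 \<in> A\<close> by (auto split: if_splits)
    show "sum_mset (r M + ?z) = sum_mset (r N + ?z)"
      using eq sm[of M] sm[of N] c by simp
  qed
  then show "M = N"
    using c split by (metis add_right_cancel)
qed

lemma is_Bh_set_singleton: "is_Bh_set h {a}"
  unfolding is_Bh_set_iff_mset
  by (metis empty_iff insert_iff set_mset_subset_singletonD)

lemma greedy_Bh_Suc_ex:
  assumes "is_Bh_set h (greedy_Bh h ` {..k})"
  shows "\<exists>n. greedy_Bh h k < n \<and> is_Bh_set h (insert n (greedy_Bh h ` {..k}))"
proof -
  define A where "A = greedy_Bh h ` {..k}"
  have A: "finite A" "0 \<in> A" "greedy_Bh h k \<in> A"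
    by (force simp: A_def)+
  define m where "m = Suc (Suc h * Max A)"
  have le: "a \<le> Max A" if "a \<in> A" for a using A that by simp
  have "h * a < m" if "a \<in> A" for a
    using le[OF that] by (simp add: m_def le_imp_less_Suc mult_le_mono2 trans_le_add2)
  then have "is_Bh_set h (insert m A)"
    using is_Bh_set_insert_large assms A(2) by (simp add: A_def)
  moreover have "greedy_Bh h k < m" using le[OF A(3)] by (simp add: m_def)
  ultimately show ?thesis by (auto simp: A_def)
qed

lemma is_Bh_set_greedy_Bh: "is_Bh_set h (greedy_Bh h ` {..k})"
proof (induction k)
  case 0
  then show ?case by (simp add: is_Bh_set_singleton)
next
  case (Suc k)
  show ?case
    using LeastI_ex[OF greedy_Bh_Suc_ex[OF Suc]] by (simp add: atMost_Suc)
qed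

lemma strict_mono_greedy_Bh: "strict_mono (greedy_Bh h)"
proof (rule strict_mono_Suc_iff[THEN iffD2], rule allI)
  fix k
  show "greedy_Bh h k < greedy_Bh h (Suc k)"
    using LeastI_ex[OF greedy_Bh_Suc_ex[OF is_Bh_set_greedy_Bh]] by simp
qed

lemma is_Bh_set_01: "is_Bh_set h {0, Suc 0}"
  using is_Bh_set_insert_large[OF is_Bh_set_singleton, of 0 h 1]
  by (simp add: insert_commute)

lemma greedy_Bh_1: "greedy_Bh h 1 = 1"
  by (auto intro!: Least_equality simp: is_Bh_set_01 insert_commute atMost_0)

lemma greedy_Bh_2:
  assumes "h \<ge> 1"
  shows "greedy_Bh h 2 = h + 1"
proof -
  have img: "greedy_Bh h ` {..1} = {0, 1}"
    using greedy_Bh_1[of h] by (auto simp: atMost_Suc simp del: greedy_Bh.simps(2))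
  have "greedy_Bh h 2 = (LEAST n. 1 < n \<and> is_Bh_set h (insert n {0, 1}))"
    by (metis Suc_1 greedy_Bh.simps(2) greedy_Bh_1 img One_nat_def)
  also have "\<dots> = h + 1"
  proof (rule Least_equality)
    have "is_Bh_set h (insert (h + 1) {0, 1})"
      by (rule is_Bh_set_insert_large) (auto simp: is_Bh_set_01)
    then show "1 < h + 1 \<and> is_Bh_set h (insert (h + 1) {0, 1})"
      using assms by simp
  next
    fix n assume n: "1 < n \<and> is_Bh_set h (insert n {0, 1})"
    show "h + 1 \<le> n"
    proof (rule ccontr)
      assume "\<not> h + 1 \<le> n"
      then have "n \<le> h" by simp
      let ?M = "replicate_mset n (1::nat) + replicate_mset (h - n) 0"
      let ?N = "add_mset n (replicate_mset (h - 1) 0)"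
      have "?M = ?N"
        using n \<open>n \<le> h\<close> assms
        by (intro n[THEN conjunct2, unfolded is_Bh_set_iff_mset, rule_format])
           (auto split: if_splits)
      then have "count ?M 1 = count ?N 1" by simp
      then show False using n by simp
    qed
  qed
  finally show ?thesis .
qed

end

theory Submission
  imports Defs
begin

text \<open>
  Since \<open>a\<^sub>2 = h + 1\<close>, the value \<open>h\<^sup>2 + h + 1\<close> exceeds every sum of \<open>h\<close> earlier elements and is
  therefore admissible. Conversely, let \<open>h + 1 < n \<le> h\<^sup>2 + h\<close> and write \<open>n = q (h + 1) + r\<close> with
  \<open>r \<le> h\<close>. If \<open>q + r \<le> h\<close>, then \<open>n\<close> is itself a sum of at most \<open>h\<close> elements of \<open>{1, h + 1}\<close>.
  Otherwise \<open>q < h\<close> and \<open>r \<ge> 2\<close>, and \<open>n + (h + 1 - r) \<cdot> 1 = (q + 1) (h + 1)\<close> is a collision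
  between two sums of at most \<open>h\<close> terms.
\<close>

text \<open>Because \<open>0 \<in> A\<close>, shorter sums may be padded with zeros.\<close>

lemma is_Bh_set_count_eq:
  assumes B: "is_Bh_set h A" and "0 \<in> A" and "x \<noteq> 0"
    and "size M \<le> h" "size N \<le> h" "set_mset M \<subseteq> A" "set_mset N \<subseteq> A"
    and "sum_mset M = sum_mset N"
  shows "count M x = count N x"
proof -
  have "M + replicate_mset (h - size M) 0 = N + replicate_mset (h - size N) 0"
    using assms by (intro B[unfolded is_Bh_set_iff_mset, rule_format]) (auto split: if_splits)
  then have "count (M + replicate_mset (h - size M) 0) x
      = count (N + replicate_mset (h - size N) 0) x" by simp
  then show ?thesis using \<open>x \<noteq> 0\<close> by simp
qed

lemma is_Bh_set_insert_lower_bound: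
  assumes B: "is_Bh_set h (insert n {0, 1, h + 1})" and n: "h + 1 < n"
  shows "h\<^sup>2 + h + 1 \<le> n"
proof (rule ccontr)
  assume "\<not> h\<^sup>2 + h + 1 \<le> n"
  then have le: "n \<le> h * (h + 1)" by (simp add: power2_eq_square)
  define q r where "q = n div (h + 1)" and "r = n mod (h + 1)"
  have nqr: "n = q * (h + 1) + r" by (simp only: q_def r_def div_mult_mod_eq)
  have r: "r \<le> h" using mod_less_divisor[of "h + 1" n] by (simp add: r_def)
  have "q * (h + 1) \<le> h * (h + 1)" using le nqr by linarith
  then have q: "q \<le> h" by (simp only: mult_le_cancel2)
  have h: "h \<ge> 1" using le n by (cases h) auto
  have "q > 0" using n nqr r by (cases q) auto
  show False
  proof (cases "q + r \<le> h")
    case True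
    let ?M = "{#n#}" and ?N = "replicate_mset q (h + 1) + replicate_mset r 1"
    \<comment> \<open>As \<open>n > h + 1\<close>, it differs from both 1 and \<open>h + 1\<close>,
      so these counts are 1 and 0; the other case ends the same way.\<close>
    have "count ?M n = count ?N n"
      using True n h nqr \<open>q > 0\<close> by (intro is_Bh_set_count_eq[OF B]) (auto split: if_splits)
    then show False using n by simp
  next
    case False
    \<comment> \<open>\<open>q = h\<close> would force \<open>r = 0\<close> because
      \<open>n \<le> h * (h + 1)\<close>, and then \<open>q + r = h\<close>.\<close>
    have "q \<noteq> h" using le nqr False by auto
    then have "q + 1 \<le> h" "r \<ge> 2" using q False by auto
    \<comment> \<open>The size of \<open>?M\<close> is \<open>h + 2 - r\<close>, which is at most
      \<open>h\<close> exactly because \<open>r \<ge> 2\<close>.\<close>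
    let ?M = "add_mset n (replicate_mset (h + 1 - r) 1)" and ?N = "replicate_mset (q + 1) (h + 1)"
    have "n + (h + 1 - r) = (q + 1) * (h + 1)" using nqr r by simp
    then have "sum_mset ?M = sum_mset ?N" by (simp del: replicate_mset_Suc)
    then have "count ?M n = count ?N n"
      using \<open>q + 1 \<le> h\<close> \<open>r \<ge> 2\<close> n r
      by (intro is_Bh_set_count_eq[OF B]) (auto split: if_splits)
    then show False using n by simp
  qed
qed

theorem theorem4:
  fixes h :: nat
  assumes "h \<ge> 1"
  shows "greedy_Bh h 3 = h\<^sup>2 + h + 1"
proof -
  have "{..2} = {0, 1, 2::nat}" by auto
  then have img: "greedy_Bh h ` {..2} = {0, 1, h + 1}"
    using greedy_Bh_1[of h] greedy_Bh_2[OF assms] by simp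
  have "greedy_Bh h 3 = (LEAST n. h + 1 < n \<and> is_Bh_set h (insert n {0, 1, h + 1}))"
    using greedy_Bh.simps(2)[of h 2]
    unfolding img greedy_Bh_2[OF assms] by (simp add: eval_nat_numeral)
  also have "\<dots> = h\<^sup>2 + h + 1"
  proof (rule Least_equality)
    have "is_Bh_set h {0, 1, h + 1}"
      using is_Bh_set_greedy_Bh[of h 2] by (simp only: img)
    then have "is_Bh_set h (insert (h\<^sup>2 + h + 1) {0, 1, h + 1})"
      by (rule is_Bh_set_insert_large) (auto simp: power2_eq_square)
    moreover have "h < h\<^sup>2 + h" using assms by simp
    ultimately show "h + 1 < h\<^sup>2 + h + 1 \<and> is_Bh_set h (insert (h\<^sup>2 + h + 1) {0, 1, h + 1})"
      by simp
  qed (use is_Bh_set_insert_lower_bound in blast)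
  finally show ?thesis .
qed

end
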